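(* Consider elements $c_{i-1},c_i,c_{i+1}$, an element $d_{i+2}$, and invertible elements $d_{i-1},d_i,d_{i+1},d'_{i-1},d'_i,d'_{i+1}$ in a ring $R$. Then the following products of matrices are equal: (i) $\mu(c_{i-1},d_i,d_{i-1}',d_{i-1})\,\mu(c_{i},d_{i+1},d_{i}',d_{i})\,\mu(c_{i+1},d_{i+2},d_{i+1}',d_{i+1})$, (ii) $\mu\bigl(-d_{i-1}(d_i')^{-1}d_{i+1}+c_{i-1}d_i^{-1}c_i,\; c_i,\; d_{i-1}',\; d_{i-1}\bigr)\cdot \mu\bigl(-d_i(d_{i+1}')^{-1}d_{i+2}+c_i d_{i+1}^{-1}c_{i+1},\; d_{i+2},\; d_{i+1}'d_i^{-1}c_i d_{i+1}^{-1}d_i',\; c_i\bigr)$.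
   Context: $R$ is a not necessarily commutative ring. For four elements $c,d,e,f$ of $R$, $\mu(c,d,e,f)$ denotes the $2\times 2$-matrix $$\mu(c,d,e,f) = \begin{pmatrix} 0 & -e^{-1}d \\ 1 & f^{-1}c \end{pmatrix},$$ an expression which is meaningful when the inverses $e^{-1}$ and $f^{-1}$ exist in $R$. *)

theory Defs
  imports "Jordan_Normal_Form.Matrix"
begin

text \<open>
  Rings are unital and not necessarily commutative.  The sort \<open>{ring, monoid_mult}\<close> is used
  instead of \<open>ring_1\<close> because the latter demands \<open>0 \<noteq> 1\<close> and so excludes the zero ring.
\<close>

definition is_inverse :: "'a::monoid_mult \<Rightarrow> 'a \<Rightarrow> bool"
  where "is_inverse x y \<longleftrightarrow> x * y = 1 \<and> y * x = 1"

definition ring_unit :: "'a::monoid_mult \<Rightarrow> bool"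
  where "ring_unit x \<longleftrightarrow> (\<exists>y. is_inverse x y)"

text \<open>The value of \<open>rinv x\<close> is unspecified unless \<open>x\<close> is a unit.\<close>

definition rinv :: "'a::monoid_mult \<Rightarrow> 'a"
  where "rinv x = (THE y. is_inverse x y)"

lemma is_inverse_unique:
  assumes "is_inverse x y" "is_inverse x z"
  shows "y = z"
proof -
  have "y = y * (x * z)" using assms by (simp add: is_inverse_def)
  also have "\<dots> = (y * x) * z" by (simp add: mult.assoc)
  also have "\<dots> = z" using assms by (simp add: is_inverse_def)
  finally show ?thesis .
qed

lemma is_inverse_rinv:
  assumes "ring_unit x"
  shows "is_inverse x (rinv x)"
  unfolding rinv_def
  using assms unfolding ring_unit_def
  by (metis is_inverse_unique theI)

text \<open>The expression is meaningful only if \<open>e\<close> and \<open>f\<close> are units.\<close>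

definition mu :: "'a::{ring, monoid_mult} \<Rightarrow> 'a \<Rightarrow> 'a \<Rightarrow> 'a \<Rightarrow> 'a mat"
  where "mu c d e f = mat_of_rows_list 2
    [[0, - rinv e * d],
     [1,   rinv f * c]]"

end

theory Submission
  imports Defs
begin

text \<open>
  Write \<open>C = c1\<inverse>\<close>, \<open>D_i = d_i\<inverse>\<close>, \<open>D_i' = d_i'\<inverse>\<close>,
  \<open>X = D_0 (c0 D_1 c1 - d0 D_1' d2) = D_0 c0 D_1 c1 - D_1' d2\<close> and
  \<open>Y = c1 D_2 c2 - d1 D_2' d3\<close>.  The first two factors on the left multiply to
  \<open>((- D_0' d1, - D_0' c1), (D_0 c0, X))\<close>, because \<open>d1\<close> cancels against \<open>D_1\<close> in the upper right
  corner.  The first factor on the right is \<open>((0, - D_0' c1), (1, X))\<close>, with the same second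
  column.  The last factor on either side has first column \<open>(0, 1)\<close> and picks out this column,
  so both products have first column \<open>(- D_0' c1, X)\<close>.  Both have \<open>- D_0' Y\<close> in the upper right
  corner.

  Only the lower right corner needs the complicated third argument
  \<open>d2' D_1 c1 D_2 d1'\<close>.  Its inverse is \<open>D_1' d2 C d1 D_2'\<close>, so the entry on the right is
  \<open>- D_1' d2 C d1 D_2' d3 + X C Y\<close>.  In \<open>X C (- d1 D_2' d3)\<close> the summand \<open>- D_1' d2\<close> of
  \<open>X\<close> contributes \<open>D_1' d2 C d1 D_2' d3\<close>, which cancels the first term, while
  \<open>D_0 c0 D_1 c1\<close> contributes \<open>- D_0 c0 D_2' d3\<close>.  What remains is
  \<open>- D_0 c0 D_2' d3 + X D_2 c2\<close>, the entry on the left.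
\<close>

lemma rinv_left: "ring_unit x \<Longrightarrow> rinv x * x = 1"
  and rinv_right: "ring_unit x \<Longrightarrow> x * rinv x = 1"
  using is_inverse_rinv by (auto simp: is_inverse_def)

text \<open>
  Products are normalised below by associating to the right, so cancellation must also work
  in front of a further factor.
\<close>

lemma rinv_left_cancel: "ring_unit x \<Longrightarrow> rinv x * (x * y) = y"
  and rinv_right_cancel: "ring_unit x \<Longrightarrow> x * (rinv x * y) = y"
  by (simp_all add: rinv_left rinv_right flip: mult.assoc)

lemma rinv_eqI: "is_inverse x y \<Longrightarrow> rinv x = y"
  by (metis is_inverse_rinv is_inverse_unique ring_unit_def)

lemma ring_unit_rinv: "ring_unit x \<Longrightarrow> ring_unit (rinv x)"
  and rinv_rinv: "ring_unit x \<Longrightarrow> rinv (rinv x) = x"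
proof -
  assume "ring_unit x"
  then have "is_inverse (rinv x) x"
    by (simp add: is_inverse_def rinv_left rinv_right)
  then show "ring_unit (rinv x)" and "rinv (rinv x) = x"
    by (auto simp: ring_unit_def intro: rinv_eqI)
qed

lemma ring_unit_mult: "ring_unit x \<Longrightarrow> ring_unit y \<Longrightarrow> ring_unit (x * y)"
  and rinv_mult: "ring_unit x \<Longrightarrow> ring_unit y \<Longrightarrow> rinv (x * y) = rinv y * rinv x"
proof -
  assume "ring_unit x" and "ring_unit y"
  then have "is_inverse (x * y) (rinv y * rinv x)"
    by (simp add: is_inverse_def mult.assoc rinv_left rinv_right
        rinv_left_cancel rinv_right_cancel)
  then show "ring_unit (x * y)" and "rinv (x * y) = rinv y * rinv x"
    by (auto simp: ring_unit_def intro: rinv_eqI)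
qed

lemma mat_of_rows_list_2_mult:
  fixes a b c d :: "'a :: semiring_0"
  shows "mat_of_rows_list 2 [[a, b], [c, d]] * mat_of_rows_list 2 [[a', b'], [c', d']]
    = mat_of_rows_list 2 [[a * a' + b * c', a * b' + b * d'], [c * a' + d * c', c * b' + d * d']]"
  by (rule eq_matI)
    (auto simp: mat_of_rows_list_def scalar_prod_def less_Suc_eq numeral_2_eq_2)

theorem proposition6p12:
  fixes c0 c1 c2 d0 d1 d2 d3 d0' d1' d2' :: "'a :: {ring, monoid_mult}"
  assumes "ring_unit d0" and "ring_unit d1" and "ring_unit d2"
    and "ring_unit d0'" and "ring_unit d1'" and "ring_unit d2'"
    and "ring_unit c1"
  shows "mu c0 d1 d0' d0 * mu c1 d2 d1' d1 * mu c2 d3 d2' d2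
       = mu (- d0 * rinv d1' * d2 + c0 * rinv d1 * c1) c1 d0' d0
       * mu (- d1 * rinv d2' * d3 + c1 * rinv d2 * c2) d3 (d2' * rinv d1 * c1 * rinv d2 * d1') c1"
proof -
  have inv: "rinv (d2' * rinv d1 * c1 * rinv d2 * d1')
      = rinv d1' * d2 * rinv c1 * d1 * rinv d2'"
    using assms by (simp add: rinv_mult rinv_rinv ring_unit_mult ring_unit_rinv mult.assoc)
  show ?thesis
    unfolding mu_def inv mat_of_rows_list_2_mult
    using assms
    by (simp add: algebra_simps rinv_left_cancel rinv_right_cancel)
qed

end
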